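(* Let $A=(a_{i,j})_{i,j=1}^n$ be an $n\times n$ complex matrix and let $\lambda$ be a complex number. If there are numbers $c_1,\ldots,c_n\in\mathbb{C}$ satisfying $$|a_{i,i}-c_i-\lambda| >\sum_{j\neq i}|a_{i,j}-c_i| \quad\text{for all } i\in\{1,\ldots,n\},$$ then $\operatorname{rank}(A-\lambda I)\ge n-1$.
   Context: $I$ denotes the $n\times n$ identity matrix. For fixed $i$, the sum $\sum_{j\neq i}$ runs over all $j\in\{1,\ldots,n\}$ with $j\neq i$. *)

theory Defs
  imports "HOL-Analysis.Analysis"
begin

end

theory Submission
  imports Defs
begin

text \<open>
  Subtracting \<open>c i\<close> from every entry of row \<open>i\<close> of \<open>A - mat \<mu>\<close> gives a strictly diagonally
  dominant, hence invertible, matrix. Its rows lie in the span of the rows of \<open>A - mat \<mu>\<close> and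
  the all-ones vector, so the rows of \<open>A - mat \<mu>\<close> span a space of codimension at most one.
\<close>

text \<open>Levy-Desplanques argument: at an index \<open>i\<close> where
  \<open>norm (x $ i)\<close> is maximal, row \<open>i\<close> of \<open>M *v x = 0\<close> bounds
  the diagonal term by the off-diagonal ones.\<close>

lemma strictly_diagonally_dominant_kernel:
  fixes M :: "'a::real_normed_field^'n^'n"
  assumes dom: "\<And>i. (\<Sum>j | j \<noteq> i. norm (M $ i $ j)) < norm (M $ i $ i)"
    and ker: "M *v x = 0"
  shows "x = 0"
proof -
  have "Max (range (\<lambda>j. norm (x $ j))) \<in> range (\<lambda>j. norm (x $ j))"
    by (rule Max_in) auto
  then obtain i where "Max (range (\<lambda>j. norm (x $ j))) = norm (x $ i)"
    by blast
  then have max: "norm (x $ j) \<le> norm (x $ i)" for j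
    by (metis Max_ge finite finite_imageI rangeI)
  have "0 = (M *v x) $ i"
    by (simp add: ker)
  also have "\<dots> = M $ i $ i * x $ i + (\<Sum>j | j \<noteq> i. M $ i $ j * x $ j)"
    by (simp add: matrix_vector_mult_def sum.remove[of UNIV i] set_diff_eq)
  finally have "norm (M $ i $ i * x $ i) = norm (\<Sum>j | j \<noteq> i. M $ i $ j * x $ j)"
    by (metis add_eq_0_iff2 norm_minus_cancel)
  also have "\<dots> \<le> (\<Sum>j | j \<noteq> i. norm (M $ i $ j) * norm (x $ i))"
    by (rule sum_norm_le) (simp add: norm_mult max mult_left_mono)
  finally have "norm (M $ i $ i) * norm (x $ i) \<le> (\<Sum>j | j \<noteq> i. norm (M $ i $ j)) * norm (x $ i)"
    by (simp add: norm_mult sum_distrib_right)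
  \<comment> \<open>If \<open>norm (x $ i)\<close> were positive, cancelling it would contradict
    dominance in row \<open>i\<close>.\<close>
  with dom[of i] have "norm (x $ i) = 0"
    by (meson linorder_not_le mult_less_cancel_right_pos norm_ge_zero order_le_less)
  with max show ?thesis
    by (simp add: vec_eq_iff)
qed

text \<open>The linear algebra half, over any field: a perturbation with entries
  \<open>c i * v $ j\<close> moves each row along the single direction \<open>v\<close>.\<close>

lemma rank_ge_of_row_shift:
  fixes B :: "'a::field^'n^'m"
  assumes "\<And>x. (\<chi> i j. B $ i $ j - c i * v $ j) *v x = 0 \<Longrightarrow> x = 0"
  shows "CARD('n) - 1 \<le> rank B"
proof -
  let ?M = "\<chi> i j. B $ i $ j - c i * v $ j"
  let ?S = "vec.span (insert v (rows B))"
  \<comment> \<open>A trivial kernel yields a left inverse, so the rows span the whole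
    space.\<close>
  have "vec.span (rows ?M) = UNIV"
    unfolding matrix_left_invertible_span_rows_gen[symmetric] matrix_left_invertible_ker
    using assms by blast
  moreover have "row i ?M \<in> ?S" for i
  proof -
    have "row i ?M = row i B - c i *s v"
      by (simp add: row_def vec_eq_iff)
    then show ?thesis
      by (auto simp: rows_def intro!: vec.span_diff vec.span_scale intro: vec.span_base)
  qed
  then have "vec.span (rows ?M) \<subseteq> ?S"
    by (intro vec.span_minimal) (auto simp: rows_def)
  ultimately have "?S = UNIV"
    by blast
  then have "CARD('n) = vec.dim (insert v (rows B))"
    by (metis vec.dim_span vec_dim_card)
  \<comment> \<open>Adjoining \<open>v\<close> raises the dimension by at most one.\<close>
  also have "\<dots> \<le> rank B + 1"
    by (simp add: vec.dim_insert row_rank_def_gen)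
  finally show ?thesis
    by simp
qed

theorem theorem1p2:
  fixes A :: "complex^'n^'n" and \<mu> :: complex and c :: "'n \<Rightarrow> complex"
  assumes "\<forall>i. cmod (A $ i $ i - c i - \<mu>) > (\<Sum>j | j \<noteq> i. cmod (A $ i $ j - c i))"
  shows "rank (A - mat \<mu>) \<ge> CARD('n) - 1"
proof (rule rank_ge_of_row_shift)
  \<comment> \<open>Taking \<open>v\<close> to be the all-ones vector shifts row \<open>i\<close> by
    the constant \<open>c i\<close>.\<close>
  let ?M = "\<chi> i j. (A - mat \<mu>) $ i $ j - c i * (\<chi> j. 1) $ j"
  have "(\<Sum>j | j \<noteq> i. cmod (?M $ i $ j)) < cmod (?M $ i $ i)" for i
  proof -
    \<comment> \<open>\<open>mat \<mu>\<close> vanishes off the diagonal, so \<mu> enters only the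
      diagonal entry.\<close>
    have "(\<Sum>j | j \<noteq> i. cmod (?M $ i $ j)) = (\<Sum>j | j \<noteq> i. cmod (A $ i $ j - c i))"
      by (rule sum.cong) (auto simp: mat_def)
    then show ?thesis
      using assms by (simp add: mat_def algebra_simps)
  qed
  then show "x = 0" if "?M *v x = 0" for x
    using that by (rule strictly_diagonally_dominant_kernel)
qed

end
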